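(* Let $(G,\mathcal{P})$ be a Euclidean framework in $\mathbb{R}^d$ with generalised distance equations $f_e(p,q)=d_e$, $e\in E$, where $p,q$ denote the parameters of the two geometric objects constrained by distance $d_e$; let $f=(f_e)_{e\in E}:\mathbb{R}^N\to\mathbb{R}^m$, $m=|E|$, be the generalised constraint map, and let $(\sigma,T)$ be a spatial symmetry of $(G,\mathcal{P})$. Then the rigidity matrix $J(G,\mathcal{P})$ satisfies the symmetry equation $$J(G,\mathcal{P})=\sigma_e^{-1}J(G,\mathcal{P})\,\sigma_v\tilde T=\sigma_e^{-1}J(G,\mathcal{P})\,\tilde T\sigma_v,$$ where $\sigma_v$ and $\sigma_e$ are the induced permutation transformations of the vertex space $\mathcal{H}_v$ and the edge space $\mathcal{H}_e$, and $\tilde T$ is the local symmetry transformation for $\sigma$.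
   Context: Let $G=(V,E)$ be a finite connected undirected graph with vertex partition $V=V_1\cup\dots\cup V_n$, $V_i=\{v_{i,k}:1\le k\le\nu_i\}$. The vertices of $V_i$ label geometric objects $p_{i,k}\subseteq\mathbb{R}^d$ all of the same ($i$-th) kind, objects of the $i$-th kind being specified by $t_i$ real parameters $\underline{x}_i\in\mathbb{R}^{t_i}$ (possibly ranging over an open subset of $\mathbb{R}^{t_i}$). For each edge $e=(v_{i,k},v_{j,l})$ there is a real-valued generalised distance function $f_e(p,q)$ of the parameters of an object $p$ of the $i$-th kind and an object $q$ of the $j$-th kind, which depends only on the kinds $i,j$ of the two objects (and not on the particular edge; it is symmetric in $p,q$ when $i=j$), and which is Euclidean invariant: $f_e(Tp,Tq)=f_e(p,q)$ for all isometries $T$ of $\mathbb{R}^d$ and all objects $p,q$ of the appropriate kinds. The pair $(G,\mathcal{P})$, with $\mathcal{P}$ the family of specified objects, together with these functions, is a Euclidean framework. Let $N=\nu_1t_1+\dots+\nu_nt_n$. The vertex space is $\mathcal{H}_v=\bigoplus_{i=1}^n\bigoplus_{k=1}^{\nu_i}\mathbb{R}^{t_i}\cong\mathbb{R}^N$ (coordinate variables for all the objects) and the edge space is $\mathcal{H}_e=\mathbb{R}^{m}$. The constraint map is $f(\underline{x})=(f_{e}(\underline{x}))_{e\in E}$ (defined on $\mathbb{R}^N$ or the relevant open subset), where $f_e$ depends only on the parameters of the two objects joined by $e$. The rigidity matrix $J(G,\mathcal{P})$ is the Jacobian derivative $Df(\underline{x})$ evaluated at the parameters $\underline{x}$ of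 the framework objects (where $f$ is assumed differentiable). A spatial symmetry $(\sigma,T)$ is an automorphism $\sigma$ of $G$ preserving each $V_i$ together with an isometry $T$ of $\mathbb{R}^d$ such that $T$ maps the object labelled by $v$ to the object labelled by $\sigma(v)$ for every $v\in V$. For each kind $i$, $T$ induces a parameter transformation $T_i$ of $\mathbb{R}^{t_i}$ (if $p$ has parameters $\underline{x}_i$ then $Tp$ has parameters $T_i\underline{x}_i$), which is taken to be linear; the local symmetry transformation is the block diagonal linear transformation $\tilde T=\bigoplus_{i=1}^n\bigoplus_{k=1}^{\nu_i}T_i$ of $\mathcal{H}_v$. The transformation $\sigma_v$ of $\mathcal{H}_v$ sends the basis vector for the $l$-th parameter of vertex $v$ to the basis vector for the $l$-th parameter of $\sigma(v)$; $\sigma_e$ sends the basis vector of edge $e$ to that of $\sigma(e)$. *)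

theory Defs
  imports "HOL-Analysis.Analysis"
begin

text \<open>
  The vertex set of the graph is the finite type 'v, and the partition of it into n kinds is the
  map kind into a finite type 'k with n = CARD('k) elements.

  The parameter spaces have different dimensions for different kinds. They are realised as
  coordinate subspaces of one space real ^ 'p: objects of kind i have the parameters with labels in
  plabels i, so t_i = card (plabels i), and the labels outside plabels i are unused. A tuple with
  one parameter vector per vertex is a vector in real ^ ('v * 'p) whose unused coordinates are 0;
  a vector indexed by the edges is a vector in real ^ ('v set) whose coordinates outside the edge
  set are 0. Thus N = card {(v, l). l \<in> plabels (kind v)} and m = card edges.
\<close>

record ('v::finite, 'k::finite, 'p::finite, 'd::finite) framework =
  edges :: "'v set set"
  kind :: "'v \<Rightarrow> 'k"
  plabels :: "'k \<Rightarrow> 'p set"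
  \<comment> \<open>the admissible parameters of each kind, and the object with given parameters\<close>
  pdom :: "'k \<Rightarrow> (real ^ 'p) set"
  obj :: "'k \<Rightarrow> real ^ 'p \<Rightarrow> (real ^ 'd) set"
  \<comment> \<open>generalised distance functions, which depend only on the two kinds\<close>
  gdist :: "'k \<Rightarrow> 'k \<Rightarrow> (real ^ 'd) set \<Rightarrow> (real ^ 'd) set \<Rightarrow> real"
  \<comment> \<open>the constants on the right-hand sides of the distance equations\<close>
  dval :: "'v set \<Rightarrow> real"
  \<comment> \<open>the parameters of all the objects of the framework\<close>
  placement :: "real ^ ('v \<times> 'p)"

definition connected_simple_graph :: "'v set set \<Rightarrow> bool" where
  "connected_simple_graph E \<longleftrightarrow>
     (\<forall>e\<in>E. card e = 2) \<and> (\<forall>u w. (u, w) \<in> {(a, b). {a, b} \<in> E}\<^sup>*)"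

definition is_isometry :: "(real ^ 'd \<Rightarrow> real ^ 'd) \<Rightarrow> bool" where
  "is_isometry T \<longleftrightarrow> surj T \<and> (\<forall>a b. dist (T a) (T b) = dist a b)"

definition param_space :: "('v::finite, 'k::finite, 'p::finite, 'd::finite) framework \<Rightarrow> 'k \<Rightarrow> (real ^ 'p) set" where
  "param_space F i = {y. \<forall>l. l \<notin> plabels F i \<longrightarrow> y $ l = 0}"

definition vertex_space ::
  "('v::finite, 'k::finite, 'p::finite, 'd::finite) framework \<Rightarrow> (real ^ ('v \<times> 'p)) set" where
  "vertex_space F = {x. \<forall>v l. l \<notin> plabels F (kind F v) \<longrightarrow> x $ (v, l) = 0}"

definition objects :: "('v::finite, 'k::finite, 'p::finite, 'd::finite) framework \<Rightarrow> 'k \<Rightarrow> (real ^ 'd) set set" where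
  "objects F i = obj F i ` pdom F i"

definition params_at ::
  "('v::finite, 'k::finite, 'p::finite, 'd::finite) framework \<Rightarrow> real ^ ('v \<times> 'p) \<Rightarrow> 'v \<Rightarrow> real ^ 'p" where
  "params_at F x v = (\<chi> l. if l \<in> plabels F (kind F v) then x $ (v, l) else 0)"

definition object_at ::
  "('v::finite, 'k::finite, 'p::finite, 'd::finite) framework \<Rightarrow> real ^ ('v \<times> 'p) \<Rightarrow> 'v \<Rightarrow> (real ^ 'd) set" where
  "object_at F x v = obj F (kind F v) (params_at F x v)"

text \<open>
  The constraint map ignores the unused coordinates of its argument, so its derivative has zero
  columns there; the rows outside the edge set are zero too. The value at an edge does not depend
  on the order of the endpoints, because the distance functions are symmetric.
\<close>

definition constraint_map ::
  "('v::finite, 'k::finite, 'p::finite, 'd::finite) framework \<Rightarrow> real ^ ('v \<times> 'p) \<Rightarrow> real ^ ('v set)" where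
  "constraint_map F x =
     (\<chi> e. if e \<in> edges F
           then (THE r. \<exists>u w. e = {u, w} \<and>
                   r = gdist F (kind F u) (kind F w) (object_at F x u) (object_at F x w))
           else 0)"

definition rigidity_matrix ::
  "('v::finite, 'k::finite, 'p::finite, 'd::finite) framework \<Rightarrow> real ^ ('v \<times> 'p) ^ ('v set)" where
  "rigidity_matrix F = jacobian (constraint_map F) (at (placement F))"

definition euclidean_invariant :: "('v::finite, 'k::finite, 'p::finite, 'd::finite) framework \<Rightarrow> bool" where
  "euclidean_invariant F \<longleftrightarrow>
     (\<forall>T i j. is_isometry T \<longrightarrow>
        (\<forall>p \<in> objects F i. \<forall>q \<in> objects F j.
           T ` p \<in> objects F i \<longrightarrow> T ` q \<in> objects F j \<longrightarrow>
           gdist F i j (T ` p) (T ` q) = gdist F i j p q))"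

definition euclidean_framework ::
  "('v::finite, 'k::finite, 'p::finite, 'd::finite) framework \<Rightarrow> bool" where
  "euclidean_framework F \<longleftrightarrow>
     connected_simple_graph (edges F) \<and>
     (\<forall>i. openin (top_of_set (param_space F i)) (pdom F i)) \<and>
     (\<forall>i. inj_on (obj F i) (pdom F i)) \<and>
     (\<forall>i j. \<forall>p \<in> objects F i. \<forall>q \<in> objects F j. gdist F i j p q = gdist F j i q p) \<and>
     euclidean_invariant F \<and>
     placement F \<in> vertex_space F \<and>
     (\<forall>v. params_at F (placement F) v \<in> pdom F (kind F v)) \<and>
     (\<forall>e \<in> edges F. constraint_map F (placement F) $ e = dval F e)"

definition spatial_symmetry ::
  "('v::finite, 'k::finite, 'p::finite, 'd::finite) framework \<Rightarrow> ('v \<Rightarrow> 'v) \<Rightarrow> (real ^ 'd \<Rightarrow> real ^ 'd) \<Rightarrow> bool" where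
  "spatial_symmetry F \<sigma> T \<longleftrightarrow>
     bij \<sigma> \<and> (\<forall>u w. {\<sigma> u, \<sigma> w} \<in> edges F \<longleftrightarrow> {u, w} \<in> edges F) \<and>
     (\<forall>v. kind F (\<sigma> v) = kind F v) \<and>
     is_isometry T \<and>
     (\<forall>v. T ` object_at F (placement F) v = object_at F (placement F) (\<sigma> v))"

text \<open>
  Tp i is the parameter transformation induced by T on objects of kind i: the object with
  parameters y is the image under T of the object with parameters x exactly when y = Tp i x.
  It is a linear transformation of param_space F i; extending it to a linear map of real ^ 'p is
  no restriction. Since the parameters may range over an open subset only, the image of an object
  under T need not have admissible parameters.
\<close>

definition induced_param_maps ::
  "('v::finite, 'k::finite, 'p::finite, 'd::finite) framework \<Rightarrow> (real ^ 'd \<Rightarrow> real ^ 'd) \<Rightarrow>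
   ('k \<Rightarrow> real ^ 'p \<Rightarrow> real ^ 'p) \<Rightarrow> bool" where
  "induced_param_maps F T Tp \<longleftrightarrow>
     (\<forall>i. linear (Tp i) \<and> Tp i ` param_space F i \<subseteq> param_space F i \<and>
        (\<forall>x \<in> pdom F i. \<forall>y \<in> pdom F i. obj F i y = T ` obj F i x \<longleftrightarrow> y = Tp i x))"

text \<open>
  In a matrix A the entry A $ a $ b lies in row a and column b. The local symmetry matrix
  is zero in the rows and columns of the unused coordinates. The two permutation matrices permute
  all coordinates; for an automorphism they preserve the vertex space and the edge space.
\<close>

definition local_symmetry_matrix ::
  "('v::finite, 'k::finite, 'p::finite, 'd::finite) framework \<Rightarrow> ('k \<Rightarrow> real ^ 'p \<Rightarrow> real ^ 'p) \<Rightarrow>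
   real ^ ('v \<times> 'p) ^ ('v \<times> 'p)" where
  "local_symmetry_matrix F Tp =
     (\<chi> a b. if fst a = fst b \<and> snd a \<in> plabels F (kind F (fst a)) \<and> snd b \<in> plabels F (kind F (fst b))
             then matrix (Tp (kind F (fst a))) $ snd a $ snd b else 0)"

definition vertex_permutation_matrix ::
  "('v::finite \<Rightarrow> 'v) \<Rightarrow> real ^ ('v \<times> 'p::finite) ^ ('v \<times> 'p)" where
  "vertex_permutation_matrix \<sigma> = (\<chi> a b. if a = (\<sigma> (fst b), snd b) then 1 else 0)"

definition edge_permutation_matrix :: "('v::finite \<Rightarrow> 'v) \<Rightarrow> real ^ ('v set) ^ ('v set)" where
  "edge_permutation_matrix \<sigma> = (\<chi> a b. if a = \<sigma> ` b then 1 else 0)"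

end

theory Submission
  imports Defs
begin

text \<open>
  Write \<open>f\<close> for the constraint map, \<open>x\<^sub>0\<close> for the placement, \<open>S\<close> for the linear transformation of
  the vertex space that applies the induced parameter transformation to every parameter vector and
  moves the result from vertex \<open>v\<close> to vertex \<open>\<sigma> v\<close>, and \<open>P\<close> for the permutation transformation of
  the edge space. Two facts carry the proof.

  First, \<open>S\<close> fixes \<open>x\<^sub>0\<close>: this is what the spatial symmetry says once objects are replaced by their
  parameters, which determine them uniquely (\<open>local_symmetry_placement\<close>).
  Second, \<open>f (S x) = P (f x)\<close> for every \<open>x\<close> near \<open>x\<^sub>0\<close>: the objects of \<open>S x\<close> are the
  images under the isometry of the objects of \<open>x\<close>, relabelled by \<open>\<sigma>\<close>, and the generalised distances
  are Euclidean invariant (\<open>constraint_map_equivariant\<close>). Invariance speaks only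
  about objects with admissible parameters, both before and after the motion. Since the admissible
  parameters form open sets and \<open>S\<close> is continuous with \<open>S x\<^sub>0 = x\<^sub>0\<close>, both conditions hold
  throughout a neighbourhood of \<open>x\<^sub>0\<close>, which is all that a derivative at \<open>x\<^sub>0\<close> depends on.

  Differentiating at \<open>x\<^sub>0\<close> and using \<open>S x\<^sub>0 = x\<^sub>0\<close> in the chain rule gives \<open>J S = P J\<close>, hence
  \<open>J = P\<^sup>-\<^sup>1 J S\<close>. The two forms of the symmetry equation agree because \<open>\<sigma>\<close> preserves kinds, so that
  relabelling the vertices commutes with transforming the parameters at each vertex.
\<close>

section \<open>The two permutation matrices and the local symmetry matrix\<close>

lemma edge_permutation_matrix_mult_vector:
  assumes "bij \<sigma>"
  shows "(edge_permutation_matrix \<sigma> *v y) $ (\<sigma> ` e) = y $ e"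
proof -
  have "(\<sigma> ` e = \<sigma> ` b) = (e = b)" for b
    using assms by (auto simp: bij_def inj_image_eq_iff)
  then show ?thesis
    by (simp add: edge_permutation_matrix_def matrix_vector_mult_def if_distrib[of "\<lambda>c. c * _"]
        cong: if_cong)
qed

lemma invertible_edge_permutation_matrix:
  fixes \<sigma> :: "'v::finite \<Rightarrow> 'v"
  assumes "bij \<sigma>"
  shows "invertible (edge_permutation_matrix \<sigma>)"
proof -
  have "inj ((*v) (edge_permutation_matrix \<sigma>))"
  proof (rule injI)
    fix y z :: "real ^ ('v set)"
    assume "edge_permutation_matrix \<sigma> *v y = edge_permutation_matrix \<sigma> *v z"
    then have "y $ e = z $ e" for e
      using edge_permutation_matrix_mult_vector[OF assms] by metis
    then show "y = z"
      by (simp add: vec_eq_iff)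
  qed
  then show ?thesis
    by (simp add: invertible_left_inverse matrix_left_invertible_injective)
qed

lemma matrix_inv_mult_left:
  assumes "invertible A"
  shows "matrix_inv A ** A = mat 1"
  using someI_ex[OF assms[unfolded invertible_def]] by (simp add: matrix_inv_def)

lemma vertex_permutation_matrix_mult_vector:
  fixes x :: "real ^ ('v::finite \<times> 'p::finite)"
  assumes "bij \<sigma>"
  shows "(vertex_permutation_matrix \<sigma> *v x) $ (\<sigma> v, l) = x $ (v, l)"
proof -
  have "((\<sigma> v, l) = (\<sigma> (fst b), snd b)) = ((v, l) = b)" for b :: "'v \<times> 'p"
    using assms by (cases b) (auto simp: bij_def inj_eq)
  then show ?thesis
    by (simp add: vertex_permutation_matrix_def matrix_vector_mult_def
        if_distrib[of "\<lambda>c. c * _"] cong: if_cong)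
qed

lemma params_at_in_param_space: "params_at F x v \<in> param_space F (kind F v)"
  by (simp add: params_at_def param_space_def)

lemma linear_params_at: "linear (\<lambda>x. params_at F x v)"
  by (rule linearI) (auto simp: params_at_def vec_eq_iff)

text \<open>
  On the unused coordinates the matrix gives 0 by definition. This agrees with the parameter
  transformation only because the latter maps the parameter space of each kind to itself.
\<close>

lemma local_symmetry_matrix_mult_vector:
  assumes "linear (Tp (kind F v))"
    and "Tp (kind F v) ` param_space F (kind F v) \<subseteq> param_space F (kind F v)"
  shows "(local_symmetry_matrix F Tp *v x) $ (v, l) = Tp (kind F v) (params_at F x v) $ l"
proof (cases "l \<in> plabels F (kind F v)")
  case True
  let ?L = "plabels F (kind F v)"
  let ?M = "matrix (Tp (kind F v))"
  have "(local_symmetry_matrix F Tp *v x) $ (v, l)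
      = (\<Sum>b\<in>UNIV. (if v = fst b \<and> snd b \<in> ?L then ?M $ l $ snd b else 0) * x $ b)"
    using True by (auto simp: local_symmetry_matrix_def matrix_vector_mult_def intro!: sum.cong)
  also have "\<dots> = (\<Sum>w\<in>UNIV. \<Sum>k\<in>UNIV. if v = w then (if k \<in> ?L then ?M $ l $ k * x $ (v, k) else 0) else 0)"
    by (subst UNIV_Times_UNIV[symmetric], subst sum.cartesian_product) (auto intro!: sum.cong)
  also have "\<dots> = (\<Sum>k\<in>UNIV. \<Sum>w\<in>UNIV. if v = w then (if k \<in> ?L then ?M $ l $ k * x $ (v, k) else 0) else 0)"
    by (rule sum.swap)
  also have "\<dots> = (\<Sum>k\<in>UNIV. if k \<in> ?L then ?M $ l $ k * x $ (v, k) else 0)"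
    by simp
  also have "\<dots> = (?M *v params_at F x v) $ l"
    by (auto simp: matrix_vector_mult_def params_at_def intro!: sum.cong)
  also have "\<dots> = Tp (kind F v) (params_at F x v) $ l"
    using assms(1) by (simp add: matrix_works)
  finally show ?thesis .
next
  case False
  have "Tp (kind F v) (params_at F x v) \<in> param_space F (kind F v)"
    using assms(2) params_at_in_param_space by blast
  with False show ?thesis
    by (simp add: local_symmetry_matrix_def matrix_vector_mult_def param_space_def)
qed

lemma vertex_permutation_local_symmetry_commute:
  fixes F :: "('v::finite, 'k::finite, 'p::finite, 'd::finite) framework"
  assumes sym: "spatial_symmetry F \<sigma> T" and ind: "induced_param_maps F T Tp"
  shows "vertex_permutation_matrix \<sigma> ** local_symmetry_matrix F Tp
       = local_symmetry_matrix F Tp ** vertex_permutation_matrix \<sigma>"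
proof -
  let ?V = "vertex_permutation_matrix \<sigma> :: real ^ ('v \<times> 'p) ^ ('v \<times> 'p)"
  let ?S = "local_symmetry_matrix F Tp"
  have bij: "bij \<sigma>" and kind: "\<And>v. kind F (\<sigma> v) = kind F v"
    using sym by (auto simp: spatial_symmetry_def)
  have Tp: "linear (Tp i)" "Tp i ` param_space F i \<subseteq> param_space F i" for i
    using ind by (auto simp: induced_param_maps_def)
  have "(?V *v (?S *v x)) $ (\<sigma> v, l) = (?S *v (?V *v x)) $ (\<sigma> v, l)" for x v l
  proof -
    have "params_at F (?V *v x) (\<sigma> v) = params_at F x v"
      by (simp add: params_at_def kind vertex_permutation_matrix_mult_vector[OF bij] vec_eq_iff)
    then show ?thesis
      by (simp add: vertex_permutation_matrix_mult_vector[OF bij]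
          local_symmetry_matrix_mult_vector[where Tp = Tp, OF Tp] kind)
  qed
  \<comment> \<open>as \<sigma> is surjective, this covers every coordinate\<close>
  then have "(?V *v (?S *v x)) $ (w, l) = (?S *v (?V *v x)) $ (w, l)" for x w l
    using bij by (metis bij_pointE)
  then have "(?V ** ?S) *v x = (?S ** ?V) *v x" for x
    by (simp add: vec_eq_iff matrix_vector_mul_assoc[symmetric] split_paired_all)
  then show ?thesis
    by (simp add: matrix_eq)
qed

section \<open>Equivariance of the constraint map near the placement\<close>

lemma params_at_local_symmetry:
  assumes sym: "spatial_symmetry F \<sigma> T" and ind: "induced_param_maps F T Tp"
  shows "params_at F ((vertex_permutation_matrix \<sigma> ** local_symmetry_matrix F Tp) *v x) (\<sigma> v)
       = Tp (kind F v) (params_at F x v)"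
proof -
  have bij: "bij \<sigma>" and kind: "\<And>v. kind F (\<sigma> v) = kind F v"
    using sym by (auto simp: spatial_symmetry_def)
  have Tp: "linear (Tp i)" "Tp i ` param_space F i \<subseteq> param_space F i" for i
    using ind by (auto simp: induced_param_maps_def)
  have "Tp (kind F v) (params_at F x v) \<in> param_space F (kind F v)"
    using Tp(2) params_at_in_param_space by blast
  then show ?thesis
    by (auto simp: params_at_def[of F "_ *v _"] vec_eq_iff kind matrix_vector_mul_assoc[symmetric]
        vertex_permutation_matrix_mult_vector[OF bij] param_space_def
        local_symmetry_matrix_mult_vector[where Tp = Tp, OF Tp])
qed

lemma local_symmetry_placement:
  assumes fw: "euclidean_framework F"
    and sym: "spatial_symmetry F \<sigma> T" and ind: "induced_param_maps F T Tp"
  shows "(vertex_permutation_matrix \<sigma> ** local_symmetry_matrix F Tp) *v placement F = placement F"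
    (is "?S *v _ = _")
proof -
  have bij: "bij \<sigma>" and kind: "\<And>v. kind F (\<sigma> v) = kind F v"
    using sym by (auto simp: spatial_symmetry_def)
  have Tp: "linear (Tp i)" "Tp i ` param_space F i \<subseteq> param_space F i" for i
    using ind by (auto simp: induced_param_maps_def)
  have adm: "params_at F (placement F) v \<in> pdom F (kind F v)" for v
    using fw by (simp add: euclidean_framework_def)
  have "(?S *v placement F) $ (\<sigma> v, l) = placement F $ (\<sigma> v, l)" for v l
  proof -
    have "obj F (kind F v) (params_at F (placement F) (\<sigma> v))
        = T ` obj F (kind F v) (params_at F (placement F) v)"
      using sym kind by (simp add: spatial_symmetry_def object_at_def)
    moreover have "params_at F (placement F) (\<sigma> v) \<in> pdom F (kind F v)"
      using adm[of "\<sigma> v"] by (simp add: kind)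
    ultimately have "params_at F (placement F) (\<sigma> v) = Tp (kind F v) (params_at F (placement F) v)"
      using ind adm by (auto simp: induced_param_maps_def)
    moreover have "(?S *v placement F) $ (\<sigma> v, l) = Tp (kind F v) (params_at F (placement F) v) $ l"
      by (simp add: matrix_vector_mul_assoc[symmetric] vertex_permutation_matrix_mult_vector[OF bij]
          local_symmetry_matrix_mult_vector[where Tp = Tp, OF Tp])
    ultimately have "(?S *v placement F) $ (\<sigma> v, l) = params_at F (placement F) (\<sigma> v) $ l"
      by simp
    \<comment> \<open>the placement vanishes on the unused coordinates, so it agrees with its parameters there\<close>
    also have "\<dots> = placement F $ (\<sigma> v, l)"
      using fw by (auto simp: params_at_def euclidean_framework_def vertex_space_def)
    finally show ?thesis .
  qed
  then have "(?S *v placement F) $ (w, l) = placement F $ (w, l)" for w l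
    using bij by (metis bij_pointE)
  then show ?thesis
    by (simp add: vec_eq_iff split_paired_all)
qed

lemma eventually_admissible:
  assumes fw: "euclidean_framework F"
  shows "\<forall>\<^sub>F x in nhds (placement F). \<forall>v. params_at F x v \<in> pdom F (kind F v)"
proof (rule eventually_all_finite)
  fix v
  obtain U where U: "open U" "pdom F (kind F v) = param_space F (kind F v) \<inter> U"
    using fw unfolding euclidean_framework_def openin_open by metis
  have "isCont (\<lambda>x. params_at F x v) (placement F)"
    by (simp add: linear_continuous_at linear_conv_bounded_linear[symmetric] linear_params_at)
  then have "((\<lambda>x. params_at F x v) \<longlongrightarrow> params_at F (placement F) v) (nhds (placement F))"
    by (simp add: isCont_def tendsto_at_iff_tendsto_nhds[of "\<lambda>x. params_at F x v"])
  moreover have "params_at F (placement F) v \<in> U"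
    using fw U(2) by (auto simp: euclidean_framework_def)
  ultimately have "\<forall>\<^sub>F x in nhds (placement F). params_at F x v \<in> U"
    using U(1) by (auto dest: topological_tendstoD)
  then show "\<forall>\<^sub>F x in nhds (placement F). params_at F x v \<in> pdom F (kind F v)"
    by eventually_elim (simp add: U(2) params_at_in_param_space)
qed

lemma edge_image_iff:
  assumes fw: "euclidean_framework F" and sym: "spatial_symmetry F \<sigma> T"
  shows "\<sigma> ` e \<in> edges F \<longleftrightarrow> e \<in> edges F"
proof -
  have inj: "inj \<sigma>" and edge: "\<And>u w. {\<sigma> u, \<sigma> w} \<in> edges F \<longleftrightarrow> {u, w} \<in> edges F"
    using sym by (auto simp: spatial_symmetry_def bij_def)
  have two: "e' \<in> edges F \<Longrightarrow> card e' = 2" for e'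
    using fw by (auto simp: euclidean_framework_def connected_simple_graph_def)
  show ?thesis
  proof (cases "card e = 2")
    case True
    then obtain u w where "e = {u, w}"
      by (auto simp: card_2_iff)
    then show ?thesis
      by (simp add: edge)
  next
    case False
    moreover have "card (\<sigma> ` e) = card e"
      using inj by (simp add: card_image inj_on_subset)
    ultimately show ?thesis
      using two by metis
  qed
qed

text \<open>
  Reading an edge \<open>e\<close> as an ordered pair of endpoints in either order, the readings of
  \<open>\<sigma> ` e\<close> are exactly the images of the readings of \<open>e\<close>, and by invariance corresponding readings
  give the same distance. So the definite descriptions defining the two values describe the same
  number.
\<close>

lemma constraint_map_equivariant:
  fixes F :: "('v::finite, 'k::finite, 'p::finite, 'd::finite) framework"
  assumes fw: "euclidean_framework F"
    and sym: "spatial_symmetry F \<sigma> T" and ind: "induced_param_maps F T Tp"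
    and S: "S = vertex_permutation_matrix \<sigma> ** local_symmetry_matrix F Tp"
    and x: "\<And>v. params_at F x v \<in> pdom F (kind F v)"
    and Sx: "\<And>v. params_at F (S *v x) v \<in> pdom F (kind F v)"
  shows "constraint_map F (S *v x) = edge_permutation_matrix \<sigma> *v constraint_map F x"
proof -
  have bij: "bij \<sigma>" and kind: "\<And>v. kind F (\<sigma> v) = kind F v" and iso: "is_isometry T"
    using sym by (auto simp: spatial_symmetry_def)
  have objects: "object_at F x v \<in> objects F (kind F v)"
    "object_at F (S *v x) v \<in> objects F (kind F v)" for v
    using x Sx by (auto simp: object_at_def objects_def)
  have image: "object_at F (S *v x) (\<sigma> v) = T ` object_at F x v" for v
  proof -
    have "params_at F (S *v x) (\<sigma> v) = Tp (kind F v) (params_at F x v)"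
      using params_at_local_symmetry[OF sym ind] by (simp add: S)
    moreover have "params_at F (S *v x) (\<sigma> v) \<in> pdom F (kind F v)"
      using Sx[of "\<sigma> v"] by (simp add: kind)
    ultimately show ?thesis
      using ind x[of v] by (simp add: induced_param_maps_def object_at_def kind)
  qed
  define g where "g y u w = gdist F (kind F u) (kind F w) (object_at F y u) (object_at F y w)"
    for y u w
  have g: "g (S *v x) (\<sigma> u) (\<sigma> w) = g x u w" for u w
  proof -
    have "T ` object_at F x u \<in> objects F (kind F u)" "T ` object_at F x w \<in> objects F (kind F w)"
      using objects(2)[of "\<sigma> u"] objects(2)[of "\<sigma> w"] by (simp_all add: image kind)
    then show ?thesis
      using fw iso objects(1)
      by (simp add: g_def image kind euclidean_framework_def euclidean_invariant_def)
  qed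
  have readings: "(\<exists>u w. \<sigma> ` e = {u, w} \<and> r = g (S *v x) u w) \<longleftrightarrow> (\<exists>u w. e = {u, w} \<and> r = g x u w)"
    for e r
  proof
    assume "\<exists>u w. \<sigma> ` e = {u, w} \<and> r = g (S *v x) u w"
    then obtain u w where "\<sigma> ` e = {\<sigma> u, \<sigma> w}" "r = g (S *v x) (\<sigma> u) (\<sigma> w)"
      using bij by (metis bij_pointE)
    moreover from this have "e = {u, w}"
      using bij inj_image_eq_iff[of \<sigma> e "{u, w}"] by (simp add: bij_def)
    ultimately show "\<exists>u w. e = {u, w} \<and> r = g x u w"
      by (auto simp: g)
  next
    assume "\<exists>u w. e = {u, w} \<and> r = g x u w"
    then obtain u w where "e = {u, w}" "r = g x u w"
      by blast
    then have "\<sigma> ` e = {\<sigma> u, \<sigma> w} \<and> r = g (S *v x) (\<sigma> u) (\<sigma> w)"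
      by (simp add: g)
    then show "\<exists>u w. \<sigma> ` e = {u, w} \<and> r = g (S *v x) u w"
      by blast
  qed
  have "constraint_map F (S *v x) $ (\<sigma> ` e) = constraint_map F x $ e" for e
    using readings[of e]
    by (simp add: constraint_map_def g_def[symmetric] edge_image_iff[OF fw sym])
  then have "constraint_map F (S *v x) $ (\<sigma> ` e)
      = (edge_permutation_matrix \<sigma> *v constraint_map F x) $ (\<sigma> ` e)" for e
    by (simp add: edge_permutation_matrix_mult_vector[OF bij])
  moreover have "\<exists>e. e' = \<sigma> ` e" for e'
    using bij by (metis bij_def image_f_inv_f)
  ultimately show ?thesis
    by (metis vec_eq_iff)
qed

section \<open>Differentiation\<close>

text \<open>
  The chain rule evaluates the derivative of \<open>\<lambda>x. f (A *v x)\<close> at \<open>a\<close> through the Jacobian of \<open>f\<close> at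
  \<open>A *v a\<close>. Because \<open>a\<close> is a fixed point, this is again the Jacobian at \<open>a\<close>, so one and the same
  matrix occurs on both sides.
\<close>

lemma jacobian_intertwines:
  fixes f :: "real ^ 'n \<Rightarrow> real ^ 'm" and A :: "real ^ 'n ^ 'n" and B :: "real ^ 'm ^ 'm"
  assumes f: "f differentiable (at a)" and fix_a: "A *v a = a"
    and eq: "\<forall>\<^sub>F x in nhds a. f (A *v x) = B *v f x"
  shows "jacobian f (at a) ** A = B ** jacobian f (at a)"
proof -
  let ?J = "jacobian f (at a)"
  have J: "(f has_derivative (*v) ?J) (at a)"
    using f by (simp add: jacobian_works)
  have "((*v) A has_derivative (*v) A) (at a)"
    by (simp add: bounded_linear_imp_has_derivative)
  moreover have "(f has_derivative (*v) ?J) (at (A *v a))"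
    using J by (simp add: fix_a)
  ultimately have "((\<lambda>x. f (A *v x)) has_derivative (\<lambda>h. ?J *v (A *v h))) (at a)"
    by (rule has_derivative_compose)
  moreover have "((\<lambda>x. B *v f x) has_derivative (\<lambda>h. B *v (?J *v h))) (at a)"
    using bounded_linear.has_derivative[OF matrix_vector_mul_bounded_linear J] .
  then have "((\<lambda>x. f (A *v x)) has_derivative (\<lambda>h. B *v (?J *v h))) (at a)"
  proof (rule has_derivative_transform_eventually)
    show "\<forall>\<^sub>F x in at a. B *v f x = f (A *v x)"
      using eq by (auto simp: eventually_at_filter elim: eventually_mono)
    show "B *v f a = f (A *v a)"
      using eventually_nhds_x_imp_x[OF eq] by simp
  qed simp
  ultimately have "(\<lambda>h. ?J *v (A *v h)) = (\<lambda>h. B *v (?J *v h))"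
    by (rule has_derivative_unique)
  then show ?thesis
    by (simp add: matrix_eq matrix_vector_mul_assoc[symmetric] fun_eq_iff)
qed

theorem theorem4p3:
  fixes F :: "('v::finite, 'k::finite, 'p::finite, 'd::finite) framework"
    and \<sigma> :: "'v \<Rightarrow> 'v"
    and T :: "real ^ 'd \<Rightarrow> real ^ 'd"
    and Tp :: "'k \<Rightarrow> real ^ 'p \<Rightarrow> real ^ 'p"
  assumes "euclidean_framework F"
    and "constraint_map F differentiable (at (placement F))"
    and "spatial_symmetry F \<sigma> T"
    and "induced_param_maps F T Tp"
  shows "rigidity_matrix F =
             matrix_inv (edge_permutation_matrix \<sigma>) ** rigidity_matrix F
               ** vertex_permutation_matrix \<sigma> ** local_symmetry_matrix F Tp
         \<and> rigidity_matrix F =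
             matrix_inv (edge_permutation_matrix \<sigma>) ** rigidity_matrix F
               ** local_symmetry_matrix F Tp ** vertex_permutation_matrix \<sigma>"
proof -
  let ?J = "rigidity_matrix F" and ?P = "edge_permutation_matrix \<sigma> :: real ^ 'v set ^ 'v set"
  define S where "S = vertex_permutation_matrix \<sigma> ** local_symmetry_matrix F Tp"
  have fixed: "S *v placement F = placement F"
    unfolding S_def by (rule local_symmetry_placement[OF assms(1,3,4)])
  have "isCont ((*v) S) (placement F)"
    by (simp add: linear_continuous_at)
  then have "((*v) S \<longlongrightarrow> S *v placement F) (nhds (placement F))"
    by (simp add: isCont_def tendsto_at_iff_tendsto_nhds)
  then have "filterlim ((*v) S) (nhds (placement F)) (nhds (placement F))"
    by (simp add: fixed)
  with eventually_admissible[OF assms(1)]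
  have "\<forall>\<^sub>F x in nhds (placement F). \<forall>v. params_at F (S *v x) v \<in> pdom F (kind F v)"
    by (rule eventually_compose_filterlim)
  with eventually_admissible[OF assms(1)]
  have "\<forall>\<^sub>F x in nhds (placement F). constraint_map F (S *v x) = ?P *v constraint_map F x"
    by eventually_elim (simp add: constraint_map_equivariant[OF assms(1,3,4) S_def])
  then have "?J ** S = ?P ** ?J"
    unfolding rigidity_matrix_def by (rule jacobian_intertwines[OF assms(2) fixed])
  moreover have "matrix_inv ?P ** ?P = mat 1"
    using assms(3) by (simp add: spatial_symmetry_def invertible_edge_permutation_matrix
        matrix_inv_mult_left)
  ultimately have "?J = matrix_inv ?P ** ?J ** S"
    by (metis matrix_mul_assoc matrix_mul_lid)
  then show ?thesis
    using vertex_permutation_local_symmetry_commute[OF assms(3,4)]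
    unfolding S_def by (metis matrix_mul_assoc)
qed

end
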